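(* Let $G$ be any graph and let $H$ be an induced subgraph of the independence graph $G^*$. Then $$\alpha^*(H|G)\le \Big(\min_{v\in\mathcal V(H)}N_v\Big)^{-1}.$$ Moreover, if $H$ is an induced subgraph of $G^*$ that is also vertex-transitive, then $$\alpha^*(H|G)\le \frac{|\mathcal V(H)|}{\sum_{v\in\mathcal V(H)}N_v}.$$
   Context: All graphs are finite, simple, undirected; $\boxtimes$ is the strong product and $\alpha^*(A|B)=\sup_W \frac{\alpha(A\boxtimes W)}{\alpha(B\boxtimes W)}$ over all graphs $W$. $\mathcal I(G)$ is the set of independent sets of $G$ (including $\emptyset$); $\mathcal S,\mathcal T\in\mathcal I(G)$ are disconnected in $G$ if $\mathcal S\cap\mathcal T=\emptyset$ and $\mathcal S\cup\mathcal T\in\mathcal I(G)$. The independence graph $G^*$ has vertex set $\mathcal I(G)$, and distinct $\mathcal S,\mathcal T$ are adjacent iff they are not disconnected (i.e. $\mathcal S\cap\mathcal T\neq\emptyset$ or $\mathcal S\cup\mathcal T\notin\mathcal I(G)$). For a vertex $v$ of $G^*$, $N_v$ is the size of the independent set of $G$ corresponding to $v$. Convention $1/0=\infty$. *)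

theory Defs
  imports
    "Graph_Theory.Pair_Digraph"
    "Graph_Theory.Digraph_Component"
    "HOL-Library.Extended_Nonnegative_Real"
begin

(* A finite simple undirected graph is a pair_graph: finite vertex set, irreflexive symmetric
   arc set, so that an edge uv is the pair of arcs (u,v), (v,u).  The graph without vertices is
   allowed. *)

definition strong_product ::
    "'a pair_pre_digraph \<Rightarrow> 'b pair_pre_digraph \<Rightarrow> ('a \<times> 'b) pair_pre_digraph"
    (infixl \<open>\<boxtimes>\<close> 70) where
  "A \<boxtimes> B = \<lparr> pverts = pverts A \<times> pverts B,
     parcs = {((a, b), (a', b')). (a, b) \<in> pverts A \<times> pverts B \<and> (a', b') \<in> pverts A \<times> pverts B
        \<and> (a, b) \<noteq> (a', b')
        \<and> (a = a' \<or> (a, a') \<in> parcs A) \<and> (b = b' \<or> (b, b') \<in> parcs B)} \<rparr>"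

definition indep_sets :: "'a pair_pre_digraph \<Rightarrow> 'a set set" where
  "indep_sets G = {S. S \<subseteq> pverts G \<and> (\<forall>u\<in>S. \<forall>v\<in>S. (u, v) \<notin> parcs G)}"

definition indep_number :: "'a pair_pre_digraph \<Rightarrow> nat" where
  "indep_number G = Max (card ` indep_sets G)"

(* W ranges over the graphs on finite subsets of nat; every finite graph is isomorphic to one of
   these, and alpha_star_upper below shows that graphs over any other type are covered.
   In ennreal, x / 0 = \<infinity> for x > 0 and 0 / 0 = 0, so the graph W without vertices
   does not affect the supremum. *)
definition alpha_star :: "'a pair_pre_digraph \<Rightarrow> 'b pair_pre_digraph \<Rightarrow> ennreal" where
  "alpha_star A B = (SUP W \<in> {W :: nat pair_pre_digraph. pair_graph W}.
     of_nat (indep_number (A \<boxtimes> W)) / of_nat (indep_number (B \<boxtimes> W)))"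

definition disconnected_in :: "'a pair_pre_digraph \<Rightarrow> 'a set \<Rightarrow> 'a set \<Rightarrow> bool" where
  "disconnected_in G S T \<longleftrightarrow> S \<inter> T = {} \<and> S \<union> T \<in> indep_sets G"

definition independence_graph :: "'a pair_pre_digraph \<Rightarrow> 'a set pair_pre_digraph" where
  "independence_graph G = \<lparr> pverts = indep_sets G,
     parcs = {(S, T). S \<in> indep_sets G \<and> T \<in> indep_sets G \<and> S \<noteq> T \<and> \<not> disconnected_in G S T} \<rparr>"

definition graph_automorphism :: "'a pair_pre_digraph \<Rightarrow> ('a \<Rightarrow> 'a) \<Rightarrow> bool" where
  "graph_automorphism G f \<longleftrightarrow> bij_betw f (pverts G) (pverts G) \<and>
     (\<forall>u\<in>pverts G. \<forall>v\<in>pverts G. (f u, f v) \<in> parcs G \<longleftrightarrow> (u, v) \<in> parcs G)"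

definition vertex_transitive :: "'a pair_pre_digraph \<Rightarrow> bool" where
  "vertex_transitive G \<longleftrightarrow>
     (\<forall>u\<in>pverts G. \<forall>v\<in>pverts G. \<exists>f. graph_automorphism G f \<and> f u = v)"

lemma pair_graphI:
  assumes "finite (pverts G)" "parcs G \<subseteq> pverts G \<times> pverts G" "irrefl (parcs G)" "sym (parcs G)"
  shows "pair_graph G"
proof -
  have "finite (parcs G)"
    using assms(1,2) by (meson finite_SigmaI finite_subset)
  then show ?thesis
    using assms by unfold_locales (auto simp: symmetric_def irrefl_def)
qed

lemma pair_graph_sym: "pair_graph G \<Longrightarrow> (u, v) \<in> parcs G \<Longrightarrow> (v, u) \<in> parcs G"
  by (meson pair_graph_def pair_pseudo_graph_def pair_sym_digraph.arcs_symmetric)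

lemma pair_graph_finite: "pair_graph G \<Longrightarrow> finite (pverts G)"
  by (meson pair_graph_def pair_digraph_def pair_fin_digraph.pair_finite_verts)

lemma pair_graph_irrefl: "pair_graph G \<Longrightarrow> (u, u) \<notin> parcs G"
  by (meson pair_graph_def pair_digraph_def pair_loopfree_digraph.no_loops')

lemma pair_graph_wf: "pair_graph G \<Longrightarrow> (u, v) \<in> parcs G \<Longrightarrow> u \<in> pverts G \<and> v \<in> pverts G"
  by (meson pair_graph_def pair_digraph_def pair_fin_digraph_def pair_wf_digraph.wellformed')

lemma pair_graph_strong_product:
  assumes "pair_graph A" "pair_graph B"
  shows "pair_graph (A \<boxtimes> B)"
  by (rule pair_graphI)
     (use assms in \<open>auto simp: strong_product_def irrefl_def sym_def pair_graph_finite
        intro: pair_graph_sym\<close>)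

lemma pair_graph_independence_graph:
  assumes "pair_graph G"
  shows "pair_graph (independence_graph G)"
proof (rule pair_graphI)
  have "indep_sets G \<subseteq> Pow (pverts G)"
    by (auto simp: indep_sets_def)
  then show "finite (pverts (independence_graph G))"
    using pair_graph_finite[OF assms] by (simp add: independence_graph_def finite_subset)
qed (auto simp: independence_graph_def irrefl_def sym_def disconnected_in_def Int_commute Un_commute)

lemma card_indep_sets_strong_product_map:
  fixes A :: "'c pair_pre_digraph" and W :: "'a pair_pre_digraph" and f :: "'a \<Rightarrow> 'b"
  assumes W: "pair_graph W" and f: "inj_on f (pverts W)"
  defines "W' \<equiv> \<lparr> pverts = f ` pverts W, parcs = map_prod f f ` parcs W \<rparr>"
  shows "card ` indep_sets (A \<boxtimes> W') = card ` indep_sets (A \<boxtimes> W)"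
proof -
  define F :: "'c \<times> 'a \<Rightarrow> 'c \<times> 'b" where "F = map_prod id f"
  have arcs: "(f u, f v) \<in> parcs W' \<longleftrightarrow> (u, v) \<in> parcs W"
    if "u \<in> pverts W" "v \<in> pverts W" for u v
  proof
    assume "(f u, f v) \<in> parcs W'"
    then obtain x y where "(x, y) \<in> parcs W" "f x = f u" "f y = f v"
      by (auto simp: W'_def)
    with that show "(u, v) \<in> parcs W"
      using pair_graph_wf[OF W] f by (metis inj_onD)
  qed (force simp: W'_def)
  have verts: "pverts (A \<boxtimes> W') = F ` pverts (A \<boxtimes> W)"
    by (force simp: strong_product_def W'_def F_def)
  have inj: "inj_on F (pverts (A \<boxtimes> W))"
    using f by (auto simp: F_def strong_product_def inj_on_def)
  have adj: "(F p, F q) \<in> parcs (A \<boxtimes> W') \<longleftrightarrow> (p, q) \<in> parcs (A \<boxtimes> W)"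
    if "p \<in> pverts (A \<boxtimes> W)" "q \<in> pverts (A \<boxtimes> W)" for p q
    using that arcs f
    by (cases p; cases q) (auto simp: F_def strong_product_def inj_on_eq_iff W'_def)
  have "indep_sets (A \<boxtimes> W') = (`) F ` indep_sets (A \<boxtimes> W)"
  proof (intro equalityI subsetI)
    fix S assume S: "S \<in> indep_sets (A \<boxtimes> W')"
    then obtain T where T: "T \<subseteq> pverts (A \<boxtimes> W)" "S = F ` T"
      using verts by (auto simp: indep_sets_def subset_image_iff)
    then have "T \<in> indep_sets (A \<boxtimes> W)"
      using S adj by (auto simp: indep_sets_def) blast
    with T show "S \<in> (`) F ` indep_sets (A \<boxtimes> W)" by blast
  next
    fix S assume "S \<in> (`) F ` indep_sets (A \<boxtimes> W)"
    then obtain T where "T \<in> indep_sets (A \<boxtimes> W)" "S = F ` T" by blast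
    then show "S \<in> indep_sets (A \<boxtimes> W')"
      using adj verts unfolding indep_sets_def by blast
  qed
  then have "card ` indep_sets (A \<boxtimes> W') = (\<lambda>T. card (F ` T)) ` indep_sets (A \<boxtimes> W)"
    by (simp only: image_image)
  also have "\<dots> = card ` indep_sets (A \<boxtimes> W)"
  proof (rule image_cong[OF refl])
    fix T assume "T \<in> indep_sets (A \<boxtimes> W)"
    then have "T \<subseteq> pverts (A \<boxtimes> W)"
      by (simp add: indep_sets_def)
    then show "card (F ` T) = card T"
      by (rule card_image[OF inj_on_subset[OF inj]])
  qed
  finally show ?thesis .
qed

lemma alpha_star_upper:
  fixes W :: "'c pair_pre_digraph"
  assumes "pair_graph W"
  shows "of_nat (indep_number (A \<boxtimes> W)) / of_nat (indep_number (B \<boxtimes> W)) \<le> alpha_star A B"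
proof -
  obtain f :: "'c \<Rightarrow> nat" where f: "inj_on f (pverts W)"
    using finite_imp_inj_to_nat_seg[OF pair_graph_finite[OF assms]] by blast
  define W' where "W' = \<lparr> pverts = f ` pverts W, parcs = map_prod f f ` parcs W \<rparr>"
  have "pair_graph W'"
  proof (rule pair_graphI)
    show "irrefl (parcs W')"
      using pair_graph_irrefl[OF assms] pair_graph_wf[OF assms] f
      by (auto simp: W'_def irrefl_def) (metis inj_onD)
    show "sym (parcs W')"
      using pair_graph_sym[OF assms] by (force simp: W'_def sym_def)
  qed (use pair_graph_finite[OF assms] pair_graph_wf[OF assms] in \<open>auto simp: W'_def\<close>)
  moreover have "indep_number (A \<boxtimes> W') = indep_number (A \<boxtimes> W)"
    "indep_number (B \<boxtimes> W') = indep_number (B \<boxtimes> W)"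
    unfolding indep_number_def W'_def card_indep_sets_strong_product_map[OF assms f]
    by (rule refl)+
  ultimately show ?thesis
    unfolding alpha_star_def by (intro SUP_upper2[of W']) auto
qed

end

(* An independent set X of H \<boxtimes> W unfolds to the set of all (g, w) with g \<in> S for some (S, w) \<in> X.
   By the definition of the independence graph this set is independent in G \<boxtimes> W and the union is
   disjoint, so it has \<Sum>(S, w)\<in>X. |S| elements.  Bounding each |S| from below by the minimum gives
   the first claim.  For vertex-transitive H, apply this to the images of X under all automorphisms
   of H and average: on average |S| is replaced by the mean of |v| over the vertices v of H. *)

theory Submission
  imports Defs
begin

text \<open>Reduces each term of the supremum defining \<open>alpha_star\<close> to an inequality of
  natural numbers. If \<open>s = 0\<close>, positivity of \<open>n\<close> makes the right side
  infinite; if \<open>a = 0\<close>, the left side is 0; otherwise \<open>a * s > 0\<close> forces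
  \<open>b > 0\<close> and real division applies.\<close>

lemma ennreal_of_nat_divide_le_cross:
  fixes a b n s :: nat
  assumes "a * s \<le> b * n" "n > 0"
  shows "of_nat a / of_nat b \<le> (of_nat n / of_nat s :: ennreal)"
proof (cases "s = 0 \<or> a = 0")
  case True
  then show ?thesis using assms(2) by (auto simp: ennreal_divide_zero)
next
  case False
  then have "b > 0"
    using assms by (cases b) auto
  have "real a * real s \<le> real b * real n"
    using assms(1) by (metis of_nat_le_iff of_nat_mult)
  then have "real a / real b \<le> real n / real s"
    using False \<open>b > 0\<close> by (simp add: field_simps)
  then have "ennreal (real a / real b) \<le> ennreal (real n / real s)"
    by (rule ennreal_leI)
  then show ?thesis
    using False \<open>b > 0\<close> by (simp add: divide_ennreal[symmetric] ennreal_of_nat_eq_real_of_nat)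
qed

lemma finite_indep_sets: "finite (pverts G) \<Longrightarrow> finite (indep_sets G)"
  by (rule finite_subset[of _ "Pow (pverts G)"]) (auto simp: indep_sets_def)

lemma card_le_indep_number:
  "finite (pverts G) \<Longrightarrow> X \<in> indep_sets G \<Longrightarrow> card X \<le> indep_number G"
  by (simp add: indep_number_def finite_indep_sets)

lemma indep_number_attained:
  assumes "finite (pverts G)"
  obtains X where "X \<in> indep_sets G" "card X = indep_number G"
proof -
  have "{} \<in> indep_sets G"
    by (simp add: indep_sets_def)
  then have "Max (card ` indep_sets G) \<in> card ` indep_sets G"
    by (intro Max_in) (auto simp: finite_indep_sets assms)
  then show ?thesis
    using that by (auto simp: indep_number_def)
qed

lemma pverts_strong_product [simp]: "pverts (A \<boxtimes> B) = pverts A \<times> pverts B"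
  by (simp add: strong_product_def)

lemma sum_card_le_indep_number_strong_product:
  fixes G :: "'a pair_pre_digraph" and W :: "'b pair_pre_digraph"
  assumes G: "pair_graph G" and W: "pair_graph W"
    and H: "induced_subgraph (with_proj H) (with_proj (independence_graph G))"
    and X: "X \<in> indep_sets (H \<boxtimes> W)"
  shows "(\<Sum>(S, w)\<in>X. card S) \<le> indep_number (G \<boxtimes> W)"
proof -
  have verts: "pverts H \<subseteq> indep_sets G"
    using H by (auto simp: induced_subgraph_def subgraph_def independence_graph_def)
  \<comment> \<open>Inducedness enters here: distinct vertices that are non-adjacent in
    \<open>H\<close> must be disconnected in \<open>G\<close>.\<close>
  have arcs: "(S, T) \<in> parcs H"
    if "S \<in> pverts H" "T \<in> pverts H" "S \<noteq> T" "\<not> disconnected_in G S T" for S T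
    using H that verts by (auto simp: induced_subgraph_def independence_graph_def)
  have XD: "S \<in> pverts H" "w \<in> pverts W" if "(S, w) \<in> X" for S w
    using X that by (auto simp: indep_sets_def)
  have fin_vert: "finite S" if "S \<in> pverts H" for S
    using that verts pair_graph_finite[OF G] by (auto simp: indep_sets_def intro: finite_subset)
  have "finite (pverts H)"
    using verts finite_indep_sets[OF pair_graph_finite[OF G]] by (rule finite_subset)
  then have "finite X"
    using X pair_graph_finite[OF W] by (auto simp: indep_sets_def intro: finite_subset)
  \<comment> \<open>With second coordinates equal or adjacent, \<open>S = T\<close> or an arc from
    \<open>S\<close> to \<open>T\<close> in \<open>H\<close> would make the two members of
    \<open>X\<close> adjacent.\<close>
  have disc: "disconnected_in G S T"
    if "(S, w) \<in> X" "(T, w') \<in> X" "(S, w) \<noteq> (T, w')" "w = w' \<or> (w, w') \<in> parcs W" for S T w w'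
  proof -
    have "((S, w), (T, w')) \<notin> parcs (H \<boxtimes> W)"
      using X that by (auto simp: indep_sets_def)
    then have "S \<noteq> T" "(S, T) \<notin> parcs H"
      using that XD by (auto simp: strong_product_def)
    then show ?thesis
      using arcs that XD by blast
  qed
  define Y where "Y = (\<Union>(S, w)\<in>X. S \<times> {w})"
  have "card Y = (\<Sum>p\<in>X. card (case p of (S, w) \<Rightarrow> S \<times> {w}))"
    unfolding Y_def
  proof (rule card_UN_disjoint)
    show "\<forall>p\<in>X. finite (case p of (S, w) \<Rightarrow> S \<times> {w})"
      using XD fin_vert by auto
    \<comment> \<open>Pieces over different vertices of \<open>W\<close> are trivially disjoint;
      over the same vertex, \<open>disc\<close> applies.\<close>
    show "\<forall>p\<in>X. \<forall>q\<in>X. p \<noteq> q \<longrightarrow>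
        (case p of (S, w) \<Rightarrow> S \<times> {w}) \<inter> (case q of (S, w) \<Rightarrow> S \<times> {w}) = {}"
      using disc unfolding disconnected_in_def by fastforce
  qed (rule \<open>finite X\<close>)
  also have "\<dots> = (\<Sum>(S, w)\<in>X. card S)"
    by (rule sum.cong) (auto simp: card_cartesian_product)
  finally have card_Y: "card Y = (\<Sum>(S, w)\<in>X. card S)" .
  have "Y \<in> indep_sets (G \<boxtimes> W)"
    unfolding indep_sets_def
  proof (intro CollectI conjI ballI)
    show "Y \<subseteq> pverts (G \<boxtimes> W)"
      using XD verts by (fastforce simp: Y_def indep_sets_def)
    fix p q assume "p \<in> Y" "q \<in> Y"
    then obtain S w g T w' h where p: "p = (g, w)" "(S, w) \<in> X" "g \<in> S"
      and q: "q = (h, w')" "(T, w') \<in> X" "h \<in> T"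
      by (auto simp: Y_def)
    show "(p, q) \<notin> parcs (G \<boxtimes> W)"
    proof
      assume "(p, q) \<in> parcs (G \<boxtimes> W)"
      then have adj: "(g, w) \<noteq> (h, w')" "g = h \<or> (g, h) \<in> parcs G" "w = w' \<or> (w, w') \<in> parcs W"
        using p q by (auto simp: strong_product_def)
      show False
      \<comment> \<open>Within one piece \<open>w = w'\<close>, so \<open>g\<close> and
        \<open>h\<close> would be adjacent inside the independent set \<open>S\<close>. Across two
        pieces, \<open>S\<close> and \<open>T\<close> are disjoint with independent union, so
        \<open>g\<close> and \<open>h\<close> are neither equal nor adjacent.\<close>
      proof (cases "(S, w) = (T, w')")
        case True
        then show False
          using adj p q XD verts by (fastforce simp: indep_sets_def)
      next
        case False
        then have "disconnected_in G S T"
          using disc p q adj by blast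
        then show False
          using adj p q by (auto simp: disconnected_in_def indep_sets_def)
      qed
    qed
  qed
  then show ?thesis
    using card_le_indep_number[of "G \<boxtimes> W" Y] G W card_Y by (simp add: pair_graph_finite)
qed

(* Automorphisms are only determined on the vertices; restricting them to be extensional
   makes their number finite. *)
definition automorphisms :: "'a pair_pre_digraph \<Rightarrow> ('a \<Rightarrow> 'a) set" where
  "automorphisms G = {f \<in> extensional (pverts G). graph_automorphism G f}"

lemma finite_automorphisms: "finite (pverts G) \<Longrightarrow> finite (automorphisms G)"
  by (rule finite_subset[of _ "pverts G \<rightarrow>\<^sub>E pverts G"])
     (auto simp: automorphisms_def graph_automorphism_def bij_betw_def extensional_def intro: finite_PiE)

lemma restrict_id_in_automorphisms: "restrict id (pverts G) \<in> automorphisms G"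
  by (auto simp: automorphisms_def graph_automorphism_def bij_betw_def inj_on_def)

lemma restrict_comp_in_automorphisms:
  assumes "f \<in> automorphisms G" "graph_automorphism G g"
  shows "restrict (f \<circ> g) (pverts G) \<in> automorphisms G"
proof -
  have f: "bij_betw f (pverts G) (pverts G)" and g: "bij_betw g (pverts G) (pverts G)"
    using assms by (auto simp: automorphisms_def graph_automorphism_def)
  have "bij_betw (restrict (f \<circ> g) (pverts G)) (pverts G) (pverts G)"
    using bij_betw_trans[OF g f] by (simp cong: bij_betw_cong)
  moreover have "g u \<in> pverts G" if "u \<in> pverts G" for u
    using g that by (auto simp: bij_betw_def)
  ultimately show ?thesis
    using assms by (simp add: automorphisms_def graph_automorphism_def)
qed

text \<open>Right composition with \<open>g\<close> permutes the finite set of automorphisms, so the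
  sum is merely reindexed.\<close>

lemma sum_automorphisms_comp:
  fixes N :: "'a \<Rightarrow> 'b::comm_monoid_add"
  assumes fin: "finite (pverts G)" and g: "graph_automorphism G g" and u: "u \<in> pverts G"
  shows "(\<Sum>f\<in>automorphisms G. N (f (g u))) = (\<Sum>f\<in>automorphisms G. N (f u))"
proof -
  let ?c = "\<lambda>f. restrict (f \<circ> g) (pverts G)"
  have sub: "?c ` automorphisms G \<subseteq> automorphisms G"
    using restrict_comp_in_automorphisms[OF _ g] by blast
  have inj: "inj_on ?c (automorphisms G)"
  proof (rule inj_onI)
    fix f h assume fh: "f \<in> automorphisms G" "h \<in> automorphisms G" "?c f = ?c h"
    show "f = h"
    proof (rule extensionalityI)
      show "f \<in> extensional (pverts G)" "h \<in> extensional (pverts G)"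
        using fh by (auto simp: automorphisms_def)
      \<comment> \<open>Surjectivity of \<open>g\<close> on the vertices allows cancelling it on the
        right.\<close>
      fix v assume "v \<in> pverts G"
      then obtain x where x: "x \<in> pverts G" "v = g x"
        using g unfolding graph_automorphism_def bij_betw_def by blast
      then show "f v = h v"
        using fun_cong[OF fh(3), of x] by simp
    qed
  qed
  have "?c ` automorphisms G = automorphisms G"
    using endo_inj_surj[OF finite_automorphisms[OF fin] sub inj] .
  then have "(\<Sum>f\<in>automorphisms G. N (f u)) = (\<Sum>f\<in>?c ` automorphisms G. N (f u))"
    by simp
  also have "\<dots> = (\<Sum>f\<in>automorphisms G. N (f (g u)))"
    using u by (simp add: sum.reindex[OF inj])
  finally show ?thesis by simp
qed

text \<open>Double counting of \<open>N (f v)\<close> over all pairs of \<open>f\<close> and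
  \<open>v\<close>: by transitivity the sum over \<open>f\<close> is the same for every
  \<open>v\<close>, while each \<open>f\<close> permutes the vertices. Cleared of denominators, this
  says that the average of \<open>N (f u)\<close> over \<open>f\<close> is the mean of
  \<open>N\<close>.\<close>

lemma sum_automorphisms_vertex_transitive:
  fixes N :: "'a \<Rightarrow> nat"
  assumes fin: "finite (pverts G)" and vt: "vertex_transitive G" and u: "u \<in> pverts G"
  shows "card (pverts G) * (\<Sum>f\<in>automorphisms G. N (f u)) =
    card (automorphisms G) * (\<Sum>v\<in>pverts G. N v)"
proof -
  have "(\<Sum>f\<in>automorphisms G. N (f v)) = (\<Sum>f\<in>automorphisms G. N (f u))"
    if v: "v \<in> pverts G" for v
  proof -
    obtain g where g: "graph_automorphism G g" "g u = v"
      using vt u v unfolding vertex_transitive_def by blast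
    show ?thesis
      using sum_automorphisms_comp[OF fin g(1) u, of N] by (simp add: g(2))
  qed
  then have "card (pverts G) * (\<Sum>f\<in>automorphisms G. N (f u)) =
      (\<Sum>v\<in>pverts G. \<Sum>f\<in>automorphisms G. N (f v))"
    by simp
  also have "\<dots> = (\<Sum>f\<in>automorphisms G. \<Sum>v\<in>pverts G. N (f v))"
    by (rule sum.swap)
  also have "\<dots> = (\<Sum>f\<in>automorphisms G. \<Sum>v\<in>pverts G. N v)"
    by (intro sum.cong refl sum.reindex_bij_betw)
       (auto simp: automorphisms_def graph_automorphism_def)
  finally show ?thesis by simp
qed

text \<open>An automorphism acting on the first coordinate preserves equality and adjacency there,
  hence non-adjacency in the product. Injectivity serves to rewrite sums over the image as sums over
  \<open>X\<close>.\<close>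

lemma automorphism_image_indep_set_strong_product:
  assumes f: "graph_automorphism H f" and X: "X \<in> indep_sets (H \<boxtimes> W)"
  shows "map_prod f id ` X \<in> indep_sets (H \<boxtimes> W)"
    and "inj_on (map_prod f id) X"
proof -
  have inj: "inj_on f (pverts H)" and img: "\<And>u. u \<in> pverts H \<Longrightarrow> f u \<in> pverts H"
    using f by (auto simp: graph_automorphism_def bij_betw_def)
  have sub: "X \<subseteq> pverts H \<times> pverts W"
    using X by (simp add: indep_sets_def)
  have "inj_on (map_prod f id) (pverts H \<times> pverts W)"
    using inj by (auto simp: inj_on_def)
  then show "inj_on (map_prod f id) X"
    using sub by (rule inj_on_subset)
  have "(map_prod f id p, map_prod f id q) \<notin> parcs (H \<boxtimes> W)" if "p \<in> X" "q \<in> X" for p q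
  proof -
    have "(p, q) \<notin> parcs (H \<boxtimes> W)" "p \<in> pverts H \<times> pverts W" "q \<in> pverts H \<times> pverts W"
      using X that by (auto simp: indep_sets_def)
    then show ?thesis
      using f inj img
      by (cases p; cases q) (auto simp: strong_product_def graph_automorphism_def inj_on_eq_iff)
  qed
  then show "map_prod f id ` X \<in> indep_sets (H \<boxtimes> W)"
    using sub img by (fastforce simp: indep_sets_def)
qed

theorem theorem6:
  fixes G :: "'a pair_pre_digraph" and H :: "'a set pair_pre_digraph"
  assumes "pair_graph G"
    and "induced_subgraph (with_proj H) (with_proj (independence_graph G))"
    and "pverts H \<noteq> {}"
  shows "alpha_star H G \<le> inverse (of_nat (Min (card ` pverts H))) \<and>
    (vertex_transitive H \<longrightarrow>
      alpha_star H G \<le> of_nat (card (pverts H)) / of_nat (\<Sum>v\<in>pverts H. card v))"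
proof (intro conjI impI)
  have fin: "finite (pverts H)"
    using assms(2) finite_indep_sets[OF pair_graph_finite[OF assms(1)]]
    by (auto simp: induced_subgraph_def subgraph_def independence_graph_def intro: finite_subset)
  let ?m = "Min (card ` pverts H)" and ?A = "automorphisms H"
    and ?n = "card (pverts H)" and ?s = "\<Sum>v\<in>pverts H. card v"
  \<comment> \<open>Needed when the empty set is the only vertex of \<open>H\<close>: then
    \<open>?s = 0\<close> and the bound must read as infinity, not as
    \<open>0 / 0 = 0\<close>.\<close>
  have n_pos: "?n > 0"
    using fin assms(3) by (simp add: card_gt_0_iff)
  \<comment> \<open>The factor 1 gives the cross-multiplied form of a bound by
    \<open>1 / ?m\<close>.\<close>
  have bound: "indep_number (H \<boxtimes> W) * ?m \<le> indep_number (G \<boxtimes> W) * 1"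
    if W: "pair_graph W" for W :: "nat pair_pre_digraph"
  proof -
    obtain X where X: "X \<in> indep_sets (H \<boxtimes> W)" "card X = indep_number (H \<boxtimes> W)"
      using indep_number_attained[of "H \<boxtimes> W"] fin pair_graph_finite[OF W] by auto
    have "card X * ?m \<le> (\<Sum>(S, w)\<in>X. card S)"
      using X(1) fin by (intro sum_bounded_below[of X ?m, simplified]) (auto simp: indep_sets_def)
    also have "\<dots> \<le> indep_number (G \<boxtimes> W)"
      by (rule sum_card_le_indep_number_strong_product[OF assms(1) W assms(2) X(1)])
    finally show ?thesis using X(2) by simp
  qed
  have "alpha_star H G \<le> of_nat 1 / of_nat ?m"
    unfolding alpha_star_def
    by (intro SUP_least ennreal_of_nat_divide_le_cross bound) auto
  then show "alpha_star H G \<le> inverse (of_nat ?m)"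
    by (simp add: divide_ennreal_def)
  assume vt: "vertex_transitive H"
  have bound_vt: "indep_number (H \<boxtimes> W) * ?s \<le> indep_number (G \<boxtimes> W) * ?n"
    if W: "pair_graph W" for W :: "nat pair_pre_digraph"
  proof -
    obtain X where X: "X \<in> indep_sets (H \<boxtimes> W)" "card X = indep_number (H \<boxtimes> W)"
      using indep_number_attained[of "H \<boxtimes> W"] fin pair_graph_finite[OF W] by auto
    have each: "(\<Sum>(S, w)\<in>X. card (f S)) \<le> indep_number (G \<boxtimes> W)" if "f \<in> ?A" for f
    proof -
      have f: "graph_automorphism H f"
        using that by (simp add: automorphisms_def)
      note img = automorphism_image_indep_set_strong_product[OF f X(1)]
      show ?thesis
        using sum_card_le_indep_number_strong_product[OF assms(1) W assms(2) img(1)]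
        by (simp add: sum.reindex[OF img(2)] case_prod_unfold)
    qed
    \<comment> \<open>The average over automorphisms is taken with both sides scaled by
      \<open>card ?A\<close>, which keeps the computation in the natural numbers.\<close>
    have "card ?A * (card X * ?s) = (\<Sum>(S, w)\<in>X. card ?A * ?s)"
      by (simp add: case_prod_unfold)
    also have "\<dots> = (\<Sum>(S, w)\<in>X. ?n * (\<Sum>f\<in>?A. card (f S)))"
    proof (rule sum.cong[OF refl])
      fix p assume "p \<in> X"
      then have "fst p \<in> pverts H"
        using X(1) by (auto simp: indep_sets_def)
      then show "(case p of (S, w) \<Rightarrow> card ?A * ?s) =
          (case p of (S, w) \<Rightarrow> ?n * (\<Sum>f\<in>?A. card (f S)))"
        using sum_automorphisms_vertex_transitive[OF fin vt, of "fst p" card]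
        by (simp add: case_prod_unfold)
    qed
    also have "\<dots> = ?n * (\<Sum>(S, w)\<in>X. \<Sum>f\<in>?A. card (f S))"
      by (simp add: case_prod_unfold sum_distrib_left)
    \<comment> \<open>After the exchange, each inner sum belongs to one image of \<open>X\<close>
      and is bounded by \<open>each\<close>.\<close>
    also have "\<dots> = ?n * (\<Sum>f\<in>?A. \<Sum>(S, w)\<in>X. card (f S))"
      unfolding case_prod_unfold by (subst sum.swap) (rule refl)
    also have "\<dots> \<le> ?n * (\<Sum>f\<in>?A. indep_number (G \<boxtimes> W))"
      by (intro mult_left_mono sum_mono each) auto
    also have "\<dots> = card ?A * (indep_number (G \<boxtimes> W) * ?n)"
      by simp
    finally have "card ?A * (card X * ?s) \<le> card ?A * (indep_number (G \<boxtimes> W) * ?n)" .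
    \<comment> \<open>The identity is an automorphism, so the common factor cancels.\<close>
    moreover have "card ?A > 0"
      using finite_automorphisms[OF fin] restrict_id_in_automorphisms by (auto simp: card_gt_0_iff)
    ultimately show ?thesis using X(2) by simp
  qed
  show "alpha_star H G \<le> of_nat ?n / of_nat ?s"
    unfolding alpha_star_def
    by (intro SUP_least ennreal_of_nat_divide_le_cross bound_vt n_pos) auto
qed

end
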